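(* For any $\varepsilon>0$ and any positive integer $n$, there exists an instance of a biobjective optimization problem that admits a one-exact $(1+\varepsilon)$-approximation set of minimum cardinality (among all one-exact $(1+\varepsilon)$-approximation sets for the instance), this minimum cardinality being $n+1$, in which all but one of the solutions are strictly dominated.
   Context: An instance of a biobjective optimization problem is a pair $(X,f)$ with a set $X$ of feasible solutions and $f=(f_1,f_2)$, $f_i:X\to\mathbb{Q}_{>0}$, both to be minimized; the set of image points $f(X)$ is finite. A solution $x\in X$ strictly dominates $x'\in X$ if $f_i(x)<f_i(x')$ for $i=1,2$; $x'$ is strictly dominated if some $x\in X$ strictly dominates it. One-exact $(1+\varepsilon)$-dominance: $x\preceq_\varepsilon^{1}x'$ iff $f_1(x)\le f_1(x')$ and $f_2(x)\le(1+\varepsilon)f_2(x')$. A one-exact $(1+\varepsilon)$-approximation set is a set $P\subseteq X$ such that for every $x'\in X$ there is $x\in P$ with $x\preceq_\varepsilon^{1}x'$. *)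

theory Defs
  imports Complex_Main
begin

definition biobj_instance :: "'a set \<Rightarrow> ('a \<Rightarrow> rat \<times> rat) \<Rightarrow> bool" where
  "biobj_instance X f \<longleftrightarrow>
     (\<forall>x\<in>X. 0 < fst (f x) \<and> 0 < snd (f x)) \<and> finite (f ` X)"

definition strictly_dominates :: "('a \<Rightarrow> rat \<times> rat) \<Rightarrow> 'a \<Rightarrow> 'a \<Rightarrow> bool" where
  "strictly_dominates f x x' \<longleftrightarrow>
     fst (f x) < fst (f x') \<and> snd (f x) < snd (f x')"

definition strictly_dominated :: "'a set \<Rightarrow> ('a \<Rightarrow> rat \<times> rat) \<Rightarrow> 'a \<Rightarrow> bool" where
  "strictly_dominated X f x' \<longleftrightarrow> (\<exists>x\<in>X. strictly_dominates f x x')"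

definition one_exact_dominates ::
    "real \<Rightarrow> ('a \<Rightarrow> rat \<times> rat) \<Rightarrow> 'a \<Rightarrow> 'a \<Rightarrow> bool" where
  "one_exact_dominates \<epsilon> f x x' \<longleftrightarrow>
     fst (f x) \<le> fst (f x') \<and>
     real_of_rat (snd (f x)) \<le> (1 + \<epsilon>) * real_of_rat (snd (f x'))"

definition one_exact_approx_set ::
    "real \<Rightarrow> 'a set \<Rightarrow> ('a \<Rightarrow> rat \<times> rat) \<Rightarrow> 'a set \<Rightarrow> bool" where
  "one_exact_approx_set \<epsilon> X f P \<longleftrightarrow>
     P \<subseteq> X \<and> (\<forall>x'\<in>X. \<exists>x\<in>P. one_exact_dominates \<epsilon> f x x')"

(* The competitors Q are restricted to finite sets because card is 0 on infinite ones;
   an infinite Q is never smaller than the finite set P. *)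
definition min_card_one_exact_approx_set ::
    "real \<Rightarrow> 'a set \<Rightarrow> ('a \<Rightarrow> rat \<times> rat) \<Rightarrow> 'a set \<Rightarrow> bool" where
  "min_card_one_exact_approx_set \<epsilon> X f P \<longleftrightarrow>
     one_exact_approx_set \<epsilon> X f P \<and> finite P \<and>
     (\<forall>Q. one_exact_approx_set \<epsilon> X f Q \<and> finite Q \<longrightarrow> card P \<le> card Q)"

end

(* With r = 1 + \<epsilon>, arrange the image points by increasing first objective in the order
   p_0, w_0, q_1, p_1, w_1, q_2, ..., p_n, w_n, with second objectives
   p_i = a^i, w_i = b^i, q_i = u a^i.  Since u < 1, the point q_i strictly dominates p_i.
   Choosing 1 \<le> r u a makes p_(i-1) cover q_i, and b \<le> a close to a makes p_i cover w_i, so the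
   p_i form an approximation set.  Choosing r b < u ensures that nothing to the left of w_i covers
   w_(i+1), so no point covers two of the w_i and every approximation set has at least n + 1
   elements.  All of this is achieved by u close to 1, b = a u^3 and 1 / (r u) < a < 1 / (r u^2). *)
theory Submission imports Defs
begin

text \<open>The point \<open>p_i\<close> has index \<open>3 * i\<close>, \<open>w_i\<close> index
  \<open>3 * i + 1\<close> and \<open>q_(i+1)\<close> index \<open>3 * i + 2\<close>, so that
  comparing first objectives amounts to comparing indices.\<close>

definition staircase :: "rat \<Rightarrow> rat \<Rightarrow> rat \<Rightarrow> nat \<Rightarrow> rat" where
  "staircase u a b x =
     (if x mod 3 = 0 then a ^ (x div 3)
      else if x mod 3 = 1 then b ^ (x div 3)
      else u * a ^ Suc (x div 3))"

lemma staircase_simps [simp]: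
  "staircase u a b (3 * i) = a ^ i"
  "staircase u a b (Suc (3 * i)) = b ^ i"
  "staircase u a b (Suc (Suc (3 * i))) = u * a ^ Suc i"
proof -
  have "Suc (3 * i) mod 3 = 1" "Suc (3 * i) div 3 = i"
    "Suc (Suc (3 * i)) mod 3 = 2" "Suc (Suc (3 * i)) div 3 = i"
    by presburger+
  then show "staircase u a b (3 * i) = a ^ i"
    "staircase u a b (Suc (3 * i)) = b ^ i"
    "staircase u a b (Suc (Suc (3 * i))) = u * a ^ Suc i"
    by (simp_all add: staircase_def)
qed

lemma nat_mod3_cases:
  fixes x :: nat
  obtains i where "x = 3 * i" | i where "x = Suc (3 * i)" | i where "x = Suc (Suc (3 * i))"
proof -
  have "x = 3 * (x div 3) \<or> x = Suc (3 * (x div 3)) \<or> x = Suc (Suc (3 * (x div 3)))"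
    by presburger
  then show ?thesis using that by blast
qed

lemma staircase_pos:
  assumes "0 < u" "0 < a" "0 < b"
  shows "0 < staircase u a b x"
  using assms by (simp add: staircase_def)

text \<open>Up to \<open>w_i\<close> only exponents at most \<open>i\<close> occur, also for the
  points \<open>q_k\<close>, and \<open>b\<close> is the smaller base. This bounds from below every
  point that can cover \<open>w_i\<close>.\<close>

lemma staircase_lower_bound:
  assumes "0 < u" "u \<le> 1" "0 < b" "b \<le> 1" "b \<le> a" "x \<le> 3 * i + 1"
  shows "u * b ^ i \<le> staircase u a b x"
proof -
  have mono: "b ^ i \<le> a ^ k" "b ^ i \<le> b ^ k" if "k \<le> i" for k
  proof -
    show le: "b ^ i \<le> b ^ k" using that assms by (intro power_decreasing) auto
    have "b ^ k \<le> a ^ k" using assms by (intro power_mono) auto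
    with le show "b ^ i \<le> a ^ k" by linarith
  qed
  have weak: "u * b ^ i \<le> b ^ i"
    using assms by (intro mult_left_le_one_le) auto
  show ?thesis
  proof (cases x rule: nat_mod3_cases)
    case (1 k)
    with weak mono(1)[of k] assms(6) show ?thesis by simp
  next
    case (2 k)
    with weak mono(2)[of k] assms(6) show ?thesis by simp
  next
    case (3 k)
    with assms(6) have "Suc k \<le> i" by simp
    from mono(1)[OF this] show ?thesis using 3 assms(1) by (simp del: power_Suc)
  qed
qed

lemma staircase_parameters:
  fixes r :: real
  assumes "1 < r"
  obtains u a b :: rat where "0 < u" "u < 1" "0 < b" "b \<le> 1" "b \<le> a"
    "1 \<le> r * (of_rat u * of_rat a)" "r * of_rat b < of_rat u"
    "\<And>i. i \<le> n \<Longrightarrow> (of_rat a :: real) ^ i \<le> r * of_rat b ^ i"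
proof -
  \<comment> \<open>Chosen so that \<open>(3 * n + 1) * (1 - \<mu>) = 1 - 1 / r\<close>. Bernoulli's
    inequality then gives \<open>1 / r \<le> U ^ (3 * n)\<close> for \<open>U\<close> between
    \<open>\<mu>\<close> and 1. The summand 1 keeps the denominator positive for
    \<open>n = 0\<close>.\<close>
  define \<mu> where "\<mu> = 1 - (1 - 1 / r) / (3 * real n + 1)"
  have gap: "0 < 1 - 1 / r" "1 - 1 / r < 1" using assms by auto
  then have "(1 - 1 / r) / (3 * real n + 1) \<le> (1 - 1 / r) / 1"
    by (intro divide_left_mono) auto
  also have "\<dots> < 1" using gap by simp
  finally have "0 < \<mu>" by (simp add: \<mu>_def)
  have "\<mu> < 1" unfolding \<mu>_def using divide_pos_pos[OF gap(1), of "3 * real n + 1"] by simp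
  then obtain u where u: "\<mu> < of_rat u" "(of_rat u :: real) < 1"
    using of_rat_dense by blast
  define U where "U = (of_rat u :: real)"
  have U: "0 < U" "U < 1" "\<mu> < U" using u \<open>0 < \<mu>\<close> unfolding U_def by linarith+
  have "3 * real n * (1 - U) \<le> (3 * real n + 1) * (1 - U)"
    using U by (intro mult_right_mono) auto
  also have "\<dots> \<le> (3 * real n + 1) * (1 - \<mu>)"
    using U by (intro mult_left_mono) auto
  also have "\<dots> = 1 - 1 / r" by (simp add: \<mu>_def)
  finally have "1 / r \<le> 1 + real (3 * n) * (U - 1)" by (simp add: algebra_simps)
  also have "\<dots> \<le> (1 + (U - 1)) ^ (3 * n)"
    using U by (intro Bernoulli_inequality) auto
  finally have Un: "1 / r \<le> U ^ (3 * n)" by simp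
  \<comment> \<open>The interval for \<open>a\<close> is nonempty because \<open>U < 1\<close>. Its
    left end yields \<open>1 < r * A * U\<close>, its right end
    \<open>r * A * U\<^sup>2 < 1\<close>.\<close>
  have "1 / (r * U) < 1 / (r * U\<^sup>2)"
    using U assms by (simp add: field_simps power2_eq_square)
  then obtain a where a: "1 / (r * U) < of_rat a" "of_rat a < 1 / (r * U\<^sup>2)"
    using of_rat_dense by blast
  define A where "A = (of_rat a :: real)"
  have "0 < 1 / (r * U)" using U assms by simp
  with a have A: "0 < A" "1 / (r * U) < A" "A < 1 / (r * U\<^sup>2)" unfolding A_def by linarith+
  \<comment> \<open>Two of the factors \<open>u\<close> bring \<open>r * a\<close> below 1, and the
    third leaves \<open>r * b < u\<close>.\<close>
  define b where "b = a * u ^ 3"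
  have B: "of_rat b = A * U ^ 3" by (simp add: b_def A_def U_def of_rat_mult of_rat_power)
  have rA: "r * A * U\<^sup>2 < 1" "1 < r * A * U"
    using A U assms by (simp_all add: field_simps)
  have rB: "r * of_rat b < U"
  proof -
    have "r * of_rat b = (r * A * U\<^sup>2) * U"
      by (simp add: B power2_eq_square power3_eq_cube)
    also have "\<dots> < U" using rA U by simp
    finally show ?thesis .
  qed
  have upos: "0 < u" "u < 1" and apos: "0 < a" using U A by (simp_all add: U_def A_def)
  then have bpos: "0 < b" by (simp add: b_def)
  show ?thesis
  proof
    show "0 < u" "u < 1" "0 < b" by fact+
    have "1 * of_rat b \<le> r * (of_rat b :: real)"
      using bpos assms by (intro mult_right_mono) auto
    with rB U(2) have "(of_rat b :: real) < 1" by linarith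
    then show "b \<le> 1" by simp
    show "b \<le> a" unfolding b_def using apos upos
      by (intro mult_left_le power_le_one) auto
    show "1 \<le> r * (of_rat u * of_rat a)"
      using rA by (simp add: A_def U_def mult.assoc mult.left_commute mult.commute)
    show "r * of_rat b < of_rat u" using rB by (simp add: U_def)
    fix i assume "i \<le> n"
    then have "U ^ (3 * n) \<le> U ^ (3 * i)" using U by (intro power_decreasing) auto
    with Un have "1 / r \<le> U ^ (3 * i)" by linarith
    then have "1 \<le> r * U ^ (3 * i)" using assms by (simp add: field_simps)
    then have "A ^ i * 1 \<le> A ^ i * (r * U ^ (3 * i))"
      using A by (intro mult_left_mono) auto
    then show "(of_rat a :: real) ^ i \<le> r * of_rat b ^ i"
      by (simp add: B A_def power_mult_distrib mult.left_commute flip: power_mult)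
  qed
qed

theorem proposition4p2:
  fixes \<epsilon> :: real and n :: nat
  assumes "\<epsilon> > 0" and "n \<ge> 1"
  shows "\<exists>(X :: nat set) f P.
           biobj_instance X f \<and>
           min_card_one_exact_approx_set \<epsilon> X f P \<and>
           card P = n + 1 \<and>
           (\<exists>!p. p \<in> P \<and> \<not> strictly_dominated X f p)"
proof -
  define r where "r = 1 + \<epsilon>"
  have r: "1 < r" using assms by (simp add: r_def)
  obtain u a b :: rat where u: "0 < u" "u < 1" and b: "0 < b" "b \<le> 1" "b \<le> a"
    and ua: "1 \<le> r * (of_rat u * of_rat a)" and rb: "r * of_rat b < of_rat u"
    and ab: "\<And>i. i \<le> n \<Longrightarrow> (of_rat a :: real) ^ i \<le> r * of_rat b ^ i"
    using staircase_parameters[OF r] by metis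
  have a: "0 < a" using b by linarith
  define g where "g = staircase u a b"
  \<comment> \<open>The successor makes the first objective positive at index 0.\<close>
  define f where "f = (\<lambda>x. (of_nat (Suc x) :: rat, g x))"
  \<comment> \<open>The last index is that of \<open>w_n\<close>, so \<open>q_(n+1)\<close> is left
    out.\<close>
  define X where "X = {..3 * n + 1}"
  define P where "P = (\<lambda>i. 3 * i) ` {..n}"
  have dom: "one_exact_dominates \<epsilon> f x y \<longleftrightarrow> x \<le> y \<and> of_rat (g x) \<le> r * of_rat (g y)" for x y
    by (simp add: one_exact_dominates_def f_def r_def)
  have sdom: "strictly_dominates f x y \<longleftrightarrow> x < y \<and> g x < g y" for x y
    by (simp add: strictly_dominates_def f_def)
  have inst: "biobj_instance X f"
    using staircase_pos[OF u(1) a b(1)] by (simp add: biobj_instance_def f_def g_def X_def)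
  have cardP: "card P = n + 1"
    by (simp add: P_def card_image inj_on_def)
  have approx: "one_exact_approx_set \<epsilon> X f P"
    unfolding one_exact_approx_set_def
  proof (intro conjI ballI)
    show "P \<subseteq> X" by (auto simp: P_def X_def)
    fix y assume y: "y \<in> X"
    show "\<exists>x\<in>P. one_exact_dominates \<epsilon> f x y"
    proof (cases y rule: nat_mod3_cases)
      case (1 i)
      have "0 < (of_rat (a ^ i) :: real)" unfolding zero_less_of_rat_iff using a by simp
      then have "one_exact_dominates \<epsilon> f (3 * i) y" using r 1 by (simp add: dom g_def)
      with 1 y show ?thesis by (auto simp: P_def X_def)
    next
      case (2 i)
      with y have i: "i \<le> n" by (simp add: X_def)
      with ab[OF i] 2 have "one_exact_dominates \<epsilon> f (3 * i) y"
        by (simp add: dom g_def of_rat_power)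
      with i show ?thesis by (auto simp: P_def)
    next
      case (3 i)
      with y have i: "i \<le> n" by (simp add: X_def)
      \<comment> \<open>Here \<open>y\<close> is \<open>q_(i+1)\<close>, covered by its predecessor
        \<open>p_i\<close>.\<close>
      have "of_rat a ^ i * 1 \<le> of_rat a ^ i * (r * (of_rat u * of_rat a))"
        using ua a by (intro mult_left_mono) auto
      then have "of_rat (g (3 * i)) \<le> r * of_rat (g y)"
        unfolding g_def 3 staircase_simps by (simp add: of_rat_power of_rat_mult mult_ac)
      then have "one_exact_dominates \<epsilon> f (3 * i) y"
        by (simp add: dom 3)
      with i show ?thesis by (auto simp: P_def)
    qed
  qed
  have lower: "card P \<le> card Q" if Q: "one_exact_approx_set \<epsilon> X f Q" "finite Q" for Q
  proof -
    \<comment> \<open>Choosing in \<open>Q\<close> a cover \<open>c i\<close> of each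
      \<open>w_i\<close> gives an injection from \<open>n + 1\<close> indices into
      \<open>Q\<close>.\<close>
    have "\<exists>x\<in>Q. one_exact_dominates \<epsilon> f x (Suc (3 * i))" if "i \<le> n" for i
      using Q(1) that by (auto simp: one_exact_approx_set_def X_def)
    then obtain c where c: "\<And>i. i \<le> n \<Longrightarrow> c i \<in> Q"
      "\<And>i. i \<le> n \<Longrightarrow> one_exact_dominates \<epsilon> f (c i) (Suc (3 * i))"
      by metis
    have neq: "c i \<noteq> c j" if "i < j" "j \<le> n" for i j
    proof
      assume eq: "c i = c j"
      \<comment> \<open>A common cover lies no further right than \<open>w_i\<close>, hence has
        value at least \<open>u * b ^ i\<close>. Covering \<open>w_j\<close> would require at most
        \<open>r * b ^ j\<close>, which is smaller since \<open>i + 1 \<le> j\<close> and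
        \<open>r * b < u\<close>.\<close>
      have "c i \<le> 3 * i + 1" using c(2)[of i] that by (simp add: dom)
      then have "u * b ^ i \<le> g (c i)"
        unfolding g_def using u b by (intro staircase_lower_bound) auto
      then have "of_rat (u * b ^ i) \<le> (of_rat (g (c i)) :: real)" by (simp only: of_rat_less_eq)
      also have "\<dots> \<le> r * of_rat b ^ j"
        using c(2)[of j] that by (simp add: dom eq g_def of_rat_power)
      also have "\<dots> \<le> r * of_rat b ^ Suc i"
        using b r that by (intro mult_left_mono power_decreasing) auto
      also have "\<dots> = (r * of_rat b) * of_rat b ^ i" by simp
      also have "\<dots> < of_rat u * of_rat b ^ i"
        using rb b by (intro mult_strict_right_mono) auto
      finally show False by (simp add: of_rat_mult of_rat_power)
    qed
    have "inj_on c {..n}"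
      by (rule linorder_inj_onI) (use neq in auto)
    then have "card {..n} \<le> card Q"
      using c(1) Q(2) by (intro card_inj_on_le[of c]) auto
    with cardP show ?thesis by simp
  qed
  have "\<exists>!p. p \<in> P \<and> \<not> strictly_dominated X f p"
  proof
    \<comment> \<open>No index is smaller than that of \<open>p_0\<close>.\<close>
    show "0 \<in> P \<and> \<not> strictly_dominated X f 0"
      by (auto simp: P_def strictly_dominated_def sdom)
    fix p assume p: "p \<in> P \<and> \<not> strictly_dominated X f p"
    then obtain i where i: "i \<le> n" "p = 3 * i" by (auto simp: P_def)
    show "p = 0"
    proof (cases i)
      case (Suc k)
      \<comment> \<open>For \<open>i = k + 1\<close> the dominating point is \<open>q_i\<close>,
        directly to the left of \<open>p_i\<close>.\<close>
      have "u * a ^ Suc k < a ^ Suc k" using u a by simp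
      then have "g (Suc (Suc (3 * k))) < g (3 * Suc k)"
        unfolding g_def staircase_simps .
      then have "strictly_dominates f (Suc (Suc (3 * k))) p"
        using i Suc by (simp add: sdom)
      moreover have "Suc (Suc (3 * k)) \<in> X" using i Suc by (simp add: X_def)
      ultimately show ?thesis using p by (auto simp: strictly_dominated_def)
    qed (use i in simp)
  qed
  moreover have "finite P" by (simp add: P_def)
  ultimately show ?thesis
    using inst approx lower cardP unfolding min_card_one_exact_approx_set_def by blast
qed

end
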